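(* Let $\mathbf{k}$ be a commutative ring and let $\alpha=(\alpha_1,\alpha_2,\ldots,\alpha_p)$ be a composition. Then the coproduct $\Delta:\operatorname{QSym}\to\operatorname{QSym}\otimes\operatorname{QSym}$ satisfies $$\Delta(\eta_\alpha)=\sum_{k=0}^{p}\eta_{(\alpha_1,\alpha_2,\ldots,\alpha_k)}\otimes\eta_{(\alpha_{k+1},\alpha_{k+2},\ldots,\alpha_p)}.$$
   Context: A composition of $n\in\{0,1,2,\ldots\}$ is a finite sequence $\alpha=(\alpha_1,\ldots,\alpha_p)$ of positive integers with sum $n$; its length is $\ell(\alpha)=p$, and $\operatorname{Comp}(n)$ is the set of compositions of $n$. For $\alpha\in\operatorname{Comp}(n)$, $\operatorname{Des}(\alpha)=\{\alpha_1,\alpha_1+\alpha_2,\ldots,\alpha_1+\cdots+\alpha_{p-1}\}\subseteq\{1,\ldots,n-1\}$. $\operatorname{QSym}\subseteq\mathbf{k}[[x_1,x_2,\ldots]]$ is the ring of quasisymmetric functions over $\mathbf{k}$, with $\mathbf{k}$-module basis the monomial quasisymmetric functions $M_\alpha=\sum_{i_1<\cdots<i_p}x_{i_1}^{\alpha_1}\cdots x_{i_p}^{\alpha_p}$. Tensor products are over $\mathbf{k}$, and $\Delta$ is the usual coproduct of the Hopf algebra $\operatorname{QSym}$, i.e. the $\mathbf{k}$-linear map with $\Delta(M_\alpha)=\sum_{k=0}^{p}M_{(\alpha_1,\ldots,\alpha_k)}\otimes M_{(\alpha_{k+1},\ldots,\alpha_p)}$ for every composition $\alpha=(\alpha_1,\ldots,\alpha_p)$.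 For $\alpha\in\operatorname{Comp}(n)$, the enriched monomial function is $\eta_\alpha=\sum_{\beta\in\operatorname{Comp}(n),\ \operatorname{Des}(\beta)\subseteq\operatorname{Des}(\alpha)}2^{\ell(\beta)}M_\beta$. *)

theory Defs
  imports Complex_Main "HOL-Library.Poly_Mapping"
begin

section \<open>Base rings\<close>

text \<open>
  The library class \<open>comm_ring_1\<close> includes the axiom \<open>0 \<noteq> 1\<close>. The class below drops it, so that
  the zero ring is allowed as a base ring. The superclass \<open>numeral\<close> adds no axiom; it only
  makes the literal \<open>2\<close> available (as \<open>1 + 1\<close>).
\<close>

class comm_unital_ring = comm_ring + comm_monoid_mult + numeral

instance comm_ring_1 \<subseteq> comm_unital_ring ..

text \<open>The library's \<open>module_hom\<close> requires \<open>comm_ring_1\<close>.\<close>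

definition linear_map ::
    "('k \<Rightarrow> 'a \<Rightarrow> 'a) \<Rightarrow> ('k \<Rightarrow> 'b \<Rightarrow> 'b) \<Rightarrow> ('a::ab_group_add \<Rightarrow> 'b::ab_group_add) \<Rightarrow> bool" where
  "linear_map s1 s2 f \<longleftrightarrow>
     (\<forall>x y. f (x + y) = f x + f y) \<and> (\<forall>c x. f (s1 c x) = s2 c (f x))"


section \<open>Compositions\<close>

definition composition :: "nat list \<Rightarrow> bool" where
  "composition \<alpha> \<longleftrightarrow> (\<forall>a\<in>set \<alpha>. 0 < a)"

definition Comp :: "nat \<Rightarrow> nat list set" where
  "Comp n = {\<alpha>. composition \<alpha> \<and> sum_list \<alpha> = n}"

definition Des :: "nat list \<Rightarrow> nat set" where
  "Des \<alpha> = {sum_list (take k \<alpha>) | k. 1 \<le> k \<and> k < length \<alpha>}"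

lemma composition_length_le: "composition \<alpha> \<Longrightarrow> length \<alpha> \<le> sum_list \<alpha>"
  by (induction \<alpha>) (auto simp: composition_def)

lemma finite_composition_le: "finite {\<alpha>. composition \<alpha> \<and> sum_list \<alpha> \<le> n}"
proof (rule finite_subset)
  show "{\<alpha>. composition \<alpha> \<and> sum_list \<alpha> \<le> n} \<subseteq> {\<alpha>. set \<alpha> \<subseteq> {..n} \<and> length \<alpha> \<le> n}"
    using composition_length_le member_le_sum_list by fastforce
  show "finite {\<alpha>. set \<alpha> \<subseteq> {..n} \<and> length \<alpha> \<le> n}"
    by (rule finite_lists_length_le) simp
qed

lemma finite_Comp [simp]: "finite (Comp n)"
  by (rule finite_subset[OF _ finite_composition_le[of n]]) (auto simp: Comp_def)


section \<open>Quasisymmetric functions\<close>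

text \<open>
  Monomials in countably many variables are finitely supported exponent vectors
  \<open>nat \<Rightarrow>\<^sub>0 nat\<close>; the variable with index \<open>i\<close> is $x_{i+1}$. A formal power series is its
  coefficient function \<open>(nat \<Rightarrow>\<^sub>0 nat) \<Rightarrow> 'k\<close>.

  \<open>power_product is \<alpha>\<close> is the monomial with exponent \<open>\<alpha> ! j\<close> at the variable \<open>is ! j\<close>.
\<close>

definition power_product :: "nat list \<Rightarrow> nat list \<Rightarrow> nat \<Rightarrow>\<^sub>0 nat" where
  "power_product is \<alpha> = sum_list (map2 Poly_Mapping.single is \<alpha>)"

definition total_degree :: "(nat \<Rightarrow>\<^sub>0 nat) \<Rightarrow> nat" where
  "total_degree m = (\<Sum>i\<in>Poly_Mapping.keys m. Poly_Mapping.lookup m i)"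

definition quasisymmetric :: "((nat \<Rightarrow>\<^sub>0 nat) \<Rightarrow> 'k::comm_unital_ring) \<Rightarrow> bool" where
  "quasisymmetric f \<longleftrightarrow>
     (\<exists>d. \<forall>m. f m \<noteq> 0 \<longrightarrow> total_degree m \<le> d) \<and>
     (\<forall>\<alpha> is js. composition \<alpha> \<and> sorted_wrt (<) is \<and> sorted_wrt (<) js \<and>
        length is = length \<alpha> \<and> length js = length \<alpha> \<longrightarrow>
        f (power_product is \<alpha>) = f (power_product js \<alpha>))"

lemma quasisymmetric_0: "quasisymmetric (\<lambda>_. 0)"
  by (simp add: quasisymmetric_def)

lemma quasisymmetric_comb:
  assumes f: "quasisymmetric f" and g: "quasisymmetric g" and h: "h 0 0 = 0"
  shows "quasisymmetric (\<lambda>m. h (f m) (g m))"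
proof -
  obtain d where d: "\<And>m. f m \<noteq> 0 \<Longrightarrow> total_degree m \<le> d"
    using f by (auto simp: quasisymmetric_def)
  obtain e where e: "\<And>m. g m \<noteq> 0 \<Longrightarrow> total_degree m \<le> e"
    using g by (auto simp: quasisymmetric_def)
  have "total_degree m \<le> max d e" if "h (f m) (g m) \<noteq> 0" for m
    using that d[of m] e[of m] h by (cases "f m = 0"; cases "g m = 0") auto
  moreover have "h (f (power_product is \<alpha>)) (g (power_product is \<alpha>)) =
      h (f (power_product js \<alpha>)) (g (power_product js \<alpha>))"
    if "composition \<alpha>" "sorted_wrt (<) is" "sorted_wrt (<) js"
      "length is = length \<alpha>" "length js = length \<alpha>" for \<alpha> "is" js
  proof -
    have "f (power_product is \<alpha>) = f (power_product js \<alpha>)"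
      using f that unfolding quasisymmetric_def by blast
    moreover have "g (power_product is \<alpha>) = g (power_product js \<alpha>)"
      using g that unfolding quasisymmetric_def by blast
    ultimately show ?thesis by simp
  qed
  ultimately show ?thesis unfolding quasisymmetric_def by blast
qed

typedef (overloaded) 'k qsym =
    "{f :: (nat \<Rightarrow>\<^sub>0 nat) \<Rightarrow> 'k::comm_unital_ring. quasisymmetric f}"
  morphisms series Abs_qsym
  using quasisymmetric_0 by blast

setup_lifting type_definition_qsym

instantiation qsym :: (comm_unital_ring) ab_group_add
begin

lift_definition zero_qsym :: "'a qsym" is "\<lambda>_. 0"
  by (rule quasisymmetric_0)

lift_definition plus_qsym :: "'a qsym \<Rightarrow> 'a qsym \<Rightarrow> 'a qsym" is "\<lambda>f g m. f m + g m"
  by (rule quasisymmetric_comb) simp_all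

lift_definition minus_qsym :: "'a qsym \<Rightarrow> 'a qsym \<Rightarrow> 'a qsym" is "\<lambda>f g m. f m - g m"
  by (rule quasisymmetric_comb) simp_all

lift_definition uminus_qsym :: "'a qsym \<Rightarrow> 'a qsym" is "\<lambda>f m. - f m"
  by (rule quasisymmetric_comb[where h = "\<lambda>x _. - x"]) simp_all

instance
  by standard (transfer; simp add: algebra_simps)+

end

lift_definition scale_qsym :: "'k::comm_unital_ring \<Rightarrow> 'k qsym \<Rightarrow> 'k qsym" is "\<lambda>c f m. c * f m"
  by (rule quasisymmetric_comb[where h = "\<lambda>x _. _ * x"]) simp_all

lemma scale_qsym_simps:
  "scale_qsym c (f + g) = scale_qsym c f + scale_qsym c g"
  "scale_qsym (c + d) f = scale_qsym c f + scale_qsym d f"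
  "scale_qsym c (scale_qsym d f) = scale_qsym (c * d) f"
  "scale_qsym 1 f = f"
  by (transfer; simp add: algebra_simps)+

lemma series_sum: "series (sum f A) m = (\<Sum>x\<in>A. series (f x) m)"
  by (induction A rule: infinite_finite_induct) (simp_all add: zero_qsym.rep_eq plus_qsym.rep_eq)


subsection \<open>Monomial quasisymmetric functions\<close>

text \<open>
  For a composition \<open>\<alpha>\<close>, each monomial is of the form \<open>power_product is \<alpha>\<close> for at most one strictly
  increasing \<open>is\<close> (see \<open>power_product_inj\<close>), so the coefficients of the defining sum of
  $M_\alpha$ are \<open>0\<close> or \<open>1\<close>.
\<close>

definition monomial_series :: "nat list \<Rightarrow> (nat \<Rightarrow>\<^sub>0 nat) \<Rightarrow> 'k::comm_unital_ring" where
  "monomial_series \<alpha> m =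
     (if \<exists>is. sorted_wrt (<) is \<and> length is = length \<alpha> \<and> m = power_product is \<alpha> then 1 else 0)"

text \<open>Meaningful for compositions \<open>\<alpha>\<close> only (see \<open>series_M\<close>).\<close>

definition M :: "nat list \<Rightarrow> 'k::comm_unital_ring qsym" where
  "M \<alpha> = Abs_qsym (monomial_series \<alpha>)"

lemma power_product_Nil [simp]: "power_product [] \<alpha> = 0" "power_product is [] = 0"
  by (simp_all add: power_product_def)

lemma power_product_Cons [simp]:
  "power_product (i # is) (a # \<alpha>) = Poly_Mapping.single i a + power_product is \<alpha>"
  by (simp add: power_product_def)

lemma lookup_power_product:
  assumes "distinct is" "length is = length \<alpha>"
  shows "map (Poly_Mapping.lookup (power_product is \<alpha>)) is = \<alpha> \<and>
         (\<forall>i. i \<notin> set is \<longrightarrow> Poly_Mapping.lookup (power_product is \<alpha>) i = 0)"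
  using assms(2,1)
proof (induction "is" \<alpha> rule: list_induct2)
  case (Cons i "is" a \<alpha>)
  have *: "Poly_Mapping.lookup (power_product (i # is) (a # \<alpha>)) j =
      Poly_Mapping.lookup (power_product is \<alpha>) j" if "j \<noteq> i" for j
    using that by (simp add: lookup_add lookup_single_not_eq)
  have **: "Poly_Mapping.lookup (power_product (i # is) (a # \<alpha>)) i = a"
    using Cons by (simp add: lookup_add)
  have "map (Poly_Mapping.lookup (power_product (i # is) (a # \<alpha>))) is =
      map (Poly_Mapping.lookup (power_product is \<alpha>)) is"
    by (rule map_cong[OF refl], rule *) (use Cons.prems in auto)
  then show ?case
    using Cons * ** by (metis distinct.simps(2) list.simps(9) list.set_intros(2) list.set_intros(1))
qed simp

lemma keys_power_product:
  assumes "distinct is" "length is = length \<alpha>" "composition \<alpha>"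
  shows "Poly_Mapping.keys (power_product is \<alpha>) = set is"
proof -
  have "Poly_Mapping.lookup (power_product is \<alpha>) i \<noteq> 0" if "i \<in> set is" for i
  proof -
    have "Poly_Mapping.lookup (power_product is \<alpha>) i \<in> set \<alpha>"
      using lookup_power_product[OF assms(1,2)] that by (metis imageI list.set_map)
    then show ?thesis using assms(3) by (auto simp: composition_def)
  qed
  then show ?thesis
    using lookup_power_product[OF assms(1,2)] by (auto simp: in_keys_iff)
qed

lemma power_product_inj:
  assumes "sorted_wrt (<) is" "length is = length \<alpha>" "composition \<alpha>"
    and "sorted_wrt (<) js" "length js = length \<beta>" "composition \<beta>"
    and eq: "power_product is \<alpha> = power_product js \<beta>"
  shows "is = js \<and> \<alpha> = \<beta>"
proof -
  have d: "distinct is" "distinct js"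
    using assms strict_sorted_iff by blast+
  have "set is = set js"
    using keys_power_product[of "is" \<alpha>] keys_power_product[of js \<beta>] assms d by simp
  then have "is = js"
    using assms by (simp add: strict_sorted_equal)
  moreover have "\<alpha> = \<beta>"
    using lookup_power_product[of "is" \<alpha>] lookup_power_product[of js \<beta>] assms d \<open>is = js\<close>
    by metis
  ultimately show ?thesis by simp
qed

lemma power_product_cases:
  obtains "is" \<alpha> where "sorted_wrt (<) is" "length is = length \<alpha>" "composition \<alpha>"
    "m = power_product is \<alpha>"
proof -
  define js where "js = sorted_list_of_set (Poly_Mapping.keys m)"
  define \<alpha> where "\<alpha> = map (Poly_Mapping.lookup m) js"
  have js: "sorted_wrt (<) js" "set js = Poly_Mapping.keys m" "distinct js"
    by (simp_all add: js_def)
  have len: "length js = length \<alpha>" by (simp add: \<alpha>_def)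
  have comp: "composition \<alpha>"
    using js by (auto simp: composition_def \<alpha>_def in_keys_iff)
  have "m = power_product js \<alpha>"
  proof (rule poly_mapping_eqI)
    fix i
    have lp: "map (Poly_Mapping.lookup (power_product js \<alpha>)) js = \<alpha>"
      "i \<notin> set js \<Longrightarrow> Poly_Mapping.lookup (power_product js \<alpha>) i = 0"
      using lookup_power_product[OF js(3) len] by blast+
    show "Poly_Mapping.lookup m i = Poly_Mapping.lookup (power_product js \<alpha>) i"
    proof (cases "i \<in> set js")
      case True
      then show ?thesis using lp(1) unfolding \<alpha>_def by (metis map_eq_conv)
    next
      case False
      then show ?thesis using lp(2) js(2) by (simp add: in_keys_iff)
    qed
  qed
  then show ?thesis using that js len comp by blast
qed

lemma total_degree_power_product:
  assumes "distinct is" "length is = length \<alpha>" "composition \<alpha>"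
  shows "total_degree (power_product is \<alpha>) = sum_list \<alpha>"
  using lookup_power_product[OF assms(1,2)] assms(1)
  by (simp add: total_degree_def keys_power_product[OF assms] sum_list_distinct_conv_sum_set[symmetric])

lemma monomial_series_power_product:
  assumes "composition \<alpha>" "composition \<beta>" "sorted_wrt (<) is" "length is = length \<beta>"
  shows "monomial_series \<alpha> (power_product is \<beta>) = (if \<alpha> = \<beta> then 1 else 0)"
  using assms power_product_inj[of "is" \<beta> _ \<alpha>] by (auto simp: monomial_series_def)

lemma quasisymmetric_monomial_series:
  assumes "composition \<alpha>"
  shows "quasisymmetric (monomial_series \<alpha>)"
  unfolding quasisymmetric_def
proof (intro conjI exI allI impI)
  fix m
  assume "monomial_series \<alpha> m \<noteq> 0"
  then obtain "is" where "sorted_wrt (<) is" "length is = length \<alpha>" "m = power_product is \<alpha>"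
    by (auto simp: monomial_series_def split: if_splits)
  then show "total_degree m \<le> sum_list \<alpha>"
    using total_degree_power_product[of "is" \<alpha>] assms strict_sorted_iff by fastforce
qed (use assms in \<open>auto simp: monomial_series_power_product\<close>)

lemma series_M:
  assumes "composition \<alpha>"
  shows "series (M \<alpha>) = monomial_series \<alpha>"
  by (simp add: M_def Abs_qsym_inverse quasisymmetric_monomial_series[OF assms])

text \<open>The coefficient of $x_1^{\alpha_1} \cdots x_p^{\alpha_p}$.\<close>

definition qcoeff :: "'k::comm_unital_ring qsym \<Rightarrow> nat list \<Rightarrow> 'k" where
  "qcoeff f \<alpha> = series f (power_product [0..<length \<alpha>] \<alpha>)"

lemma series_power_product:
  assumes "composition \<alpha>" "sorted_wrt (<) is" "length is = length \<alpha>"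
  shows "series f (power_product is \<alpha>) = qcoeff f \<alpha>"
proof -
  have "quasisymmetric (series f)" using series[of f] by simp
  moreover have "sorted_wrt (<) [0..<length \<alpha>]" "length [0..<length \<alpha>] = length \<alpha>"
    by simp_all
  ultimately show ?thesis
    using assms unfolding quasisymmetric_def qcoeff_def by blast
qed

lemma qcoeff_simps:
  "qcoeff (f + g) \<alpha> = qcoeff f \<alpha> + qcoeff g \<alpha>"
  "qcoeff (scale_qsym c f) \<alpha> = c * qcoeff f \<alpha>"
  by (simp_all add: qcoeff_def plus_qsym.rep_eq scale_qsym.rep_eq)

lemma qcoeff_M:
  assumes "composition \<alpha>" "composition \<beta>"
  shows "qcoeff (M \<alpha>) \<beta> = (if \<alpha> = \<beta> then 1 else 0)"
  using assms by (simp add: qcoeff_def series_M monomial_series_power_product)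

lemma finite_qcoeff: "finite {\<alpha>. composition \<alpha> \<and> qcoeff f \<alpha> \<noteq> 0}"
proof -
  have "quasisymmetric (series f)" using series[of f] by simp
  then obtain d where d: "\<And>m. series f m \<noteq> 0 \<Longrightarrow> total_degree m \<le> d"
    by (auto simp: quasisymmetric_def)
  have "{\<alpha>. composition \<alpha> \<and> qcoeff f \<alpha> \<noteq> 0} \<subseteq> {\<alpha>. composition \<alpha> \<and> sum_list \<alpha> \<le> d}"
  proof safe
    fix \<alpha> assume "composition \<alpha>" "qcoeff f \<alpha> \<noteq> 0"
    then show "sum_list \<alpha> \<le> d"
      using d[of "power_product [0..<length \<alpha>] \<alpha>"]
        total_degree_power_product[of "[0..<length \<alpha>]" \<alpha>] by (simp add: qcoeff_def)
  qed
  then show ?thesis using finite_composition_le finite_subset by blast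
qed

lemma M_expansion:
  "f = (\<Sum>\<alpha> | composition \<alpha> \<and> qcoeff f \<alpha> \<noteq> 0. scale_qsym (qcoeff f \<alpha>) (M \<alpha>))"
    (is "f = sum ?g ?A")
proof -
  have "series f m = series (sum ?g ?A) m" for m
  proof -
    obtain "is" \<beta> where m: "sorted_wrt (<) is" "length is = length \<beta>" "composition \<beta>"
      "m = power_product is \<beta>"
      by (rule power_product_cases)
    have "series (sum ?g ?A) m = (\<Sum>\<alpha>\<in>?A. qcoeff f \<alpha> * qcoeff (M \<alpha>) \<beta>)"
      using m by (simp add: series_sum series_power_product qcoeff_simps)
    also have "\<dots> = (\<Sum>\<alpha>\<in>?A. if \<alpha> = \<beta> then qcoeff f \<beta> else 0)"
      by (rule sum.cong) (use m in \<open>auto simp: qcoeff_M\<close>)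
    also have "\<dots> = qcoeff f \<beta>"
      using m finite_qcoeff[of f] by (simp add: sum.delta)
    finally show ?thesis using m by (simp add: series_power_product)
  qed
  then have "series f = series (sum ?g ?A)" by (rule ext)
  then show ?thesis by (simp only: series_inject)
qed


section \<open>Tensor products\<close>

text \<open>
  The tensor product of two modules with underlying additive groups \<open>'a\<close> and \<open>'b\<close> is the free module
  \<open>('a \<times> 'b) \<Rightarrow>\<^sub>0 'k\<close> modulo the submodule \<open>tensor_relations\<close> generated by the bilinearity relations.
\<close>

abbreviation free_gen :: "'a \<Rightarrow> 'b \<Rightarrow> ('a \<times> 'b) \<Rightarrow>\<^sub>0 'k::comm_unital_ring" where
  "free_gen x y \<equiv> Poly_Mapping.single (x, y) 1"

definition scale_free :: "'k::comm_unital_ring \<Rightarrow> ('x \<Rightarrow>\<^sub>0 'k) \<Rightarrow> ('x \<Rightarrow>\<^sub>0 'k)" where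
  "scale_free c = Poly_Mapping.map (\<lambda>x. c * x)"

inductive_set tensor_relations ::
    "('k::comm_unital_ring \<Rightarrow> 'a::ab_group_add \<Rightarrow> 'a) \<Rightarrow> ('k \<Rightarrow> 'b::ab_group_add \<Rightarrow> 'b) \<Rightarrow>
     (('a \<times> 'b) \<Rightarrow>\<^sub>0 'k) set"
  for s1 s2 where
  zero: "0 \<in> tensor_relations s1 s2"
| add: "u \<in> tensor_relations s1 s2 \<Longrightarrow> v \<in> tensor_relations s1 s2 \<Longrightarrow>
    u + v \<in> tensor_relations s1 s2"
| scale: "u \<in> tensor_relations s1 s2 \<Longrightarrow> scale_free c u \<in> tensor_relations s1 s2"
| add_left: "free_gen (x + x') y - free_gen x y - free_gen x' y \<in> tensor_relations s1 s2"
| add_right: "free_gen x (y + y') - free_gen x y - free_gen x y' \<in> tensor_relations s1 s2"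
| scale_left: "free_gen (s1 c x) y - scale_free c (free_gen x y) \<in> tensor_relations s1 s2"
| scale_right: "free_gen x (s2 c y) - scale_free c (free_gen x y) \<in> tensor_relations s1 s2"

lemma lookup_scale_free [simp]: "Poly_Mapping.lookup (scale_free c u) i = c * Poly_Mapping.lookup u i"
  unfolding scale_free_def Poly_Mapping.map.rep_eq
  by (cases "Poly_Mapping.lookup u i = 0") simp_all

lemma scale_free_simps:
  "scale_free c (u + v) = scale_free c u + scale_free c v"
  "scale_free c (u - v) = scale_free c u - scale_free c v"
  "scale_free (c + d) u = scale_free c u + scale_free d u"
  "scale_free c (scale_free d u) = scale_free (c * d) u"
  "scale_free 1 u = u"
  "scale_free (- 1) u = - u"
  by (rule poly_mapping_eqI,
      simp only: lookup_scale_free lookup_add lookup_minus lookup_uminus distrib_left distrib_right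
        right_diff_distrib mult.assoc mult_1_left mult_minus_left)+

lemma tensor_relations_uminus:
  "u \<in> tensor_relations s1 s2 \<Longrightarrow> - u \<in> tensor_relations s1 s2"
  using tensor_relations.scale[of u s1 s2 "- 1"] by (simp add: scale_free_simps)

lemma tensor_relations_diff:
  "u \<in> tensor_relations s1 s2 \<Longrightarrow> v \<in> tensor_relations s1 s2 \<Longrightarrow> u - v \<in> tensor_relations s1 s2"
  using tensor_relations.add[of u s1 s2 "- v"] tensor_relations_uminus[of v s1 s2] by simp

definition tensor_eq ::
    "(('k::comm_unital_ring qsym \<times> 'k qsym) \<Rightarrow>\<^sub>0 'k) \<Rightarrow> (('k qsym \<times> 'k qsym) \<Rightarrow>\<^sub>0 'k) \<Rightarrow> bool" where
  "tensor_eq u v \<longleftrightarrow> u - v \<in> tensor_relations scale_qsym scale_qsym"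

lemma equivp_tensor_eq: "equivp tensor_eq"
proof (rule equivpI)
  show "reflp tensor_eq"
    by (simp add: reflp_def tensor_eq_def tensor_relations.zero)
  show "symp tensor_eq"
    unfolding symp_def tensor_eq_def using tensor_relations_uminus by fastforce
  show "transp tensor_eq"
    unfolding transp_def tensor_eq_def using tensor_relations.add by fastforce
qed

quotient_type (overloaded) 'k qsym_tensor =
    "('k::comm_unital_ring qsym \<times> 'k qsym) \<Rightarrow>\<^sub>0 'k" / tensor_eq
  by (rule equivp_tensor_eq)

instantiation qsym_tensor :: (comm_unital_ring) ab_group_add
begin

lift_definition zero_qsym_tensor :: "'a qsym_tensor" is 0 .

lift_definition plus_qsym_tensor :: "'a qsym_tensor \<Rightarrow> 'a qsym_tensor \<Rightarrow> 'a qsym_tensor" is "(+)"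
  by (simp only: tensor_eq_def add_diff_add tensor_relations.add)

lift_definition minus_qsym_tensor :: "'a qsym_tensor \<Rightarrow> 'a qsym_tensor \<Rightarrow> 'a qsym_tensor" is "(-)"
proof -
  fix u u' v v' :: "('a qsym \<times> 'a qsym) \<Rightarrow>\<^sub>0 'a"
  assume "tensor_eq u u'" "tensor_eq v v'"
  moreover have "(u - v) - (u' - v') = (u - u') - (v - v')" by simp
  ultimately show "tensor_eq (u - v) (u' - v')"
    by (simp only: tensor_eq_def tensor_relations_diff)
qed

lift_definition uminus_qsym_tensor :: "'a qsym_tensor \<Rightarrow> 'a qsym_tensor" is uminus
  by (simp only: tensor_eq_def minus_diff_minus tensor_relations_uminus)

instance
proof
  fix a b c :: "'a qsym_tensor"
  show "a + b + c = a + (b + c)"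
    by transfer (simp add: tensor_eq_def tensor_relations.zero add.assoc)
  show "a + b = b + a"
    by transfer (simp add: tensor_eq_def tensor_relations.zero add.commute)
  show "0 + a = a" and "- a + a = 0" and "a - b = a + - b"
    by (transfer; simp add: tensor_eq_def tensor_relations.zero)+
qed

end

lift_definition scale_tensor :: "'k::comm_unital_ring \<Rightarrow> 'k qsym_tensor \<Rightarrow> 'k qsym_tensor"
  is scale_free
  by (simp only: tensor_eq_def scale_free_simps(2)[symmetric] tensor_relations.scale)

definition tensor :: "'k::comm_unital_ring qsym \<Rightarrow> 'k qsym \<Rightarrow> 'k qsym_tensor"
  (infixl \<open>\<otimes>\<close> 70) where
  "f \<otimes> g = abs_qsym_tensor (free_gen f g)"

lemma tensor_bilinear:
  "(f + f') \<otimes> g = f \<otimes> g + f' \<otimes> g"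
  "f \<otimes> (g + g') = f \<otimes> g + f \<otimes> g'"
  "scale_qsym c f \<otimes> g = scale_tensor c (f \<otimes> g)"
  "f \<otimes> scale_qsym c g = scale_tensor c (f \<otimes> g)"
  unfolding tensor_def plus_qsym_tensor.abs_eq scale_tensor.abs_eq qsym_tensor.abs_eq_iff
    tensor_eq_def diff_diff_add[symmetric]
  by (rule tensor_relations.add_left tensor_relations.add_right
      tensor_relations.scale_left tensor_relations.scale_right)+

lemma scale_tensor_simps:
  "scale_tensor c (t + u) = scale_tensor c t + scale_tensor c u"
  "scale_tensor (c + d) t = scale_tensor c t + scale_tensor d t"
  "scale_tensor c (scale_tensor d t) = scale_tensor (c * d) t"
  "scale_tensor 1 t = t"
  by (transfer; simp add: tensor_eq_def scale_free_simps tensor_relations.zero)+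


section \<open>The coproduct\<close>

lemma linear_map_0: "linear_map s1 s2 f \<Longrightarrow> f 0 = 0"
  unfolding linear_map_def by (metis add_cancel_right_left)

lemma linear_map_sum: "linear_map s1 s2 f \<Longrightarrow> f (sum g A) = (\<Sum>x\<in>A. f (g x))"
  by (induction A rule: infinite_finite_induct) (auto simp: linear_map_0, auto simp: linear_map_def)

lemma scale_tensor_0 [simp]: "scale_tensor 0 t = 0"
  using scale_tensor_simps(2)[of 0 0 t] by simp

lemma scale_tensor_sum: "scale_tensor c (sum g A) = (\<Sum>x\<in>A. scale_tensor c (g x))"
proof -
  have "linear_map scale_tensor scale_tensor (scale_tensor c)"
    by (simp add: linear_map_def scale_tensor_simps mult.commute)
  then show ?thesis by (rule linear_map_sum)
qed

lemma linear_map_qsym_ex1: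
  "\<exists>!D. linear_map scale_qsym scale_tensor D \<and> (\<forall>\<alpha>. composition \<alpha> \<longrightarrow> D (M \<alpha>) = T \<alpha>)"
proof (rule ex_ex1I)
  define D where
    "D f = (\<Sum>\<alpha> | composition \<alpha> \<and> qcoeff f \<alpha> \<noteq> 0. scale_tensor (qcoeff f \<alpha>) (T \<alpha>))" for f
  have D: "D f = (\<Sum>\<alpha>\<in>A. scale_tensor (qcoeff f \<alpha>) (T \<alpha>))"
    if "finite A" "A \<subseteq> Collect composition" "{\<alpha>. composition \<alpha> \<and> qcoeff f \<alpha> \<noteq> 0} \<subseteq> A" for f A
    unfolding D_def by (rule sum.mono_neutral_left) (use that in auto)
  have "D (f + g) = D f + D g" for f g
  proof -
    let ?S = "\<lambda>f. {\<alpha>. composition \<alpha> \<and> qcoeff f \<alpha> \<noteq> 0}"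
    let ?A = "?S f \<union> ?S g"
    have A: "finite ?A" "?A \<subseteq> Collect composition" using finite_qcoeff by auto
    have "?S (f + g) \<subseteq> ?A" by (auto simp: qcoeff_simps)
    from D[OF A this] D[OF A, of f] D[OF A, of g] show ?thesis
      by (simp add: qcoeff_simps scale_tensor_simps sum.distrib)
  qed
  moreover have "D (scale_qsym c f) = scale_tensor c (D f)" for c f
  proof -
    let ?A = "{\<alpha>. composition \<alpha> \<and> qcoeff f \<alpha> \<noteq> 0}"
    have A: "finite ?A" "?A \<subseteq> Collect composition" using finite_qcoeff by auto
    have "{\<alpha>. composition \<alpha> \<and> qcoeff (scale_qsym c f) \<alpha> \<noteq> 0} \<subseteq> ?A" by (auto simp: qcoeff_simps)
    from D[OF A this] D[OF A, of f] show ?thesis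
      by (simp add: qcoeff_simps scale_tensor_simps scale_tensor_sum)
  qed
  moreover have "D (M \<alpha>) = T \<alpha>" if "composition \<alpha>" for \<alpha>
  proof -
    have "D (M \<alpha>) = (\<Sum>\<beta>\<in>{\<alpha>}. scale_tensor (qcoeff (M \<alpha>) \<beta>) (T \<beta>))"
      by (rule D) (use that in \<open>auto simp: qcoeff_M split: if_splits\<close>)
    then show ?thesis using that by (simp add: qcoeff_M scale_tensor_simps)
  qed
  ultimately show "\<exists>D. linear_map scale_qsym scale_tensor D \<and>
      (\<forall>\<alpha>. composition \<alpha> \<longrightarrow> D (M \<alpha>) = T \<alpha>)"
    unfolding linear_map_def by blast
next
  fix D E
  assume D: "linear_map scale_qsym scale_tensor D \<and> (\<forall>\<alpha>. composition \<alpha> \<longrightarrow> D (M \<alpha>) = T \<alpha>)"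
    and E: "linear_map scale_qsym scale_tensor E \<and> (\<forall>\<alpha>. composition \<alpha> \<longrightarrow> E (M \<alpha>) = T \<alpha>)"
  have expand: "F f = (\<Sum>\<alpha> | composition \<alpha> \<and> qcoeff f \<alpha> \<noteq> 0. scale_tensor (qcoeff f \<alpha>) (T \<alpha>))"
    if F: "linear_map scale_qsym scale_tensor F \<and> (\<forall>\<alpha>. composition \<alpha> \<longrightarrow> F (M \<alpha>) = T \<alpha>)" for F f
  proof -
    have "F f = F (\<Sum>\<alpha> | composition \<alpha> \<and> qcoeff f \<alpha> \<noteq> 0. scale_qsym (qcoeff f \<alpha>) (M \<alpha>))"
      using M_expansion[of f] by simp
    also have "\<dots> = (\<Sum>\<alpha> | composition \<alpha> \<and> qcoeff f \<alpha> \<noteq> 0. F (scale_qsym (qcoeff f \<alpha>) (M \<alpha>)))"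
      using F linear_map_sum by blast
    also have "\<dots> = (\<Sum>\<alpha> | composition \<alpha> \<and> qcoeff f \<alpha> \<noteq> 0. scale_tensor (qcoeff f \<alpha>) (T \<alpha>))"
      by (rule sum.cong) (use F in \<open>auto simp: linear_map_def\<close>)
    finally show ?thesis .
  qed
  show "D = E"
    by (rule ext) (simp only: expand[OF D] expand[OF E])
qed

definition coproduct :: "'k::comm_unital_ring qsym \<Rightarrow> 'k qsym_tensor" (\<open>\<Delta>\<close>) where
  "\<Delta> = (THE D. linear_map scale_qsym scale_tensor D \<and>
     (\<forall>\<alpha>. composition \<alpha> \<longrightarrow> D (M \<alpha>) = (\<Sum>k=0..length \<alpha>. M (take k \<alpha>) \<otimes> M (drop k \<alpha>))))"

lemma coproduct_linear: "linear_map scale_qsym scale_tensor \<Delta>"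
  and coproduct_M:
    "composition \<alpha> \<Longrightarrow> \<Delta> (M \<alpha>) = (\<Sum>k=0..length \<alpha>. M (take k \<alpha>) \<otimes> M (drop k \<alpha>))"
  using theI'[OF linear_map_qsym_ex1[of "\<lambda>\<alpha>. \<Sum>k=0..length \<alpha>. M (take k \<alpha>) \<otimes> M (drop k \<alpha>)"]]
  unfolding coproduct_def[symmetric] by blast+


section \<open>Enriched monomial functions\<close>

definition enriched_monomial :: "nat list \<Rightarrow> 'k::comm_unital_ring qsym" (\<open>\<eta>\<close>) where
  "\<eta> \<alpha> = (\<Sum>\<beta> | \<beta> \<in> Comp (sum_list \<alpha>) \<and> Des \<beta> \<subseteq> Des \<alpha>. scale_qsym (2 ^ length \<beta>) (M \<beta>))"

end

(*
  For compositions of the same size, Des beta \<subseteq> Des alpha means that every partial sum of beta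
  is a partial sum of alpha. Cutting beta after its k-th entry therefore determines a unique place to
  cut alpha at the same partial sum, and the two halves of beta are coarsenings of the two halves of
  alpha; conversely, coarsenings of the two halves concatenate to a coarsening of alpha. This
  matches the terms of the two sides, and the weights agree because length is additive.
*)
theory Submission
  imports Defs
begin

text \<open>In contrast to \<open>Des\<close>, the endpoints 0 and the total are kept, which gives a
  clean rule for concatenation even when one factor is empty.\<close>

definition partial_sums :: "nat list \<Rightarrow> nat set" where
  "partial_sums \<alpha> = (\<lambda>k. sum_list (take k \<alpha>)) ` {0..length \<alpha>}"

definition coarsenings :: "nat list \<Rightarrow> nat list set" where
  "coarsenings \<alpha> =
     {\<beta>. composition \<beta> \<and> sum_list \<beta> = sum_list \<alpha> \<and> partial_sums \<beta> \<subseteq> partial_sums \<alpha>}"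

lemma composition_append [simp]: "composition (\<alpha> @ \<beta>) \<longleftrightarrow> composition \<alpha> \<and> composition \<beta>"
  by (auto simp: composition_def)

lemma composition_take: "composition \<alpha> \<Longrightarrow> composition (take k \<alpha>)"
  by (auto simp: composition_def dest: in_set_takeD)

lemma composition_drop: "composition \<alpha> \<Longrightarrow> composition (drop k \<alpha>)"
  by (auto simp: composition_def dest: in_set_dropD)

text \<open>The segment between the two positions is a nonempty composition, so its sum is at least
  its length and hence positive.\<close>

lemma sum_list_take_strict_mono:
  assumes "composition \<alpha>" "i < j" "j \<le> length \<alpha>"
  shows "sum_list (take i \<alpha>) < sum_list (take j \<alpha>)"
proof -
  have "take j \<alpha> = take i \<alpha> @ take (j - i) (drop i \<alpha>)"
    using assms(2) by (metis le_add_diff_inverse less_imp_le take_add)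
  moreover have "0 < length (take (j - i) (drop i \<alpha>))"
    using assms(2,3) by simp
  moreover have "composition (take (j - i) (drop i \<alpha>))"
    using assms(1) by (intro composition_take composition_drop)
  ultimately show ?thesis
    using composition_length_le[of "take (j - i) (drop i \<alpha>)"]
    by (metis le_less_trans less_add_same_cancel1 linorder_not_less sum_list_append)
qed

lemma sum_list_take_inj:
  assumes "composition \<alpha>" "i \<le> length \<alpha>" "j \<le> length \<alpha>"
    and "sum_list (take i \<alpha>) = sum_list (take j \<alpha>)"
  shows "i = j"
  using assms sum_list_take_strict_mono[of \<alpha> i j] sum_list_take_strict_mono[of \<alpha> j i]
  by (cases i j rule: linorder_cases) auto

text \<open>Positions up to the seam see only the first list; later ones add its full sum. The seam
  is counted in both pieces, which a union tolerates.\<close>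

lemma partial_sums_append:
  "partial_sums (\<alpha> @ \<beta>) = partial_sums \<alpha> \<union> (+) (sum_list \<alpha>) ` partial_sums \<beta>"
proof -
  let ?s = "\<lambda>k. sum_list (take k (\<alpha> @ \<beta>))"
  have split: "{0..length (\<alpha> @ \<beta>)} = {0..length \<alpha>} \<union> (+) (length \<alpha>) ` {0..length \<beta>}"
    by (auto simp: image_add_atLeastAtMost)
  have "?s ` {0..length \<alpha>} = partial_sums \<alpha>"
    unfolding partial_sums_def by (rule image_cong) simp_all
  moreover have "?s ` (+) (length \<alpha>) ` {0..length \<beta>} = (+) (sum_list \<alpha>) ` partial_sums \<beta>"
    unfolding partial_sums_def image_image by (rule image_cong) simp_all
  ultimately show ?thesis
    unfolding partial_sums_def[of "\<alpha> @ \<beta>"] split image_Un by simp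
qed

lemma partial_sums_le:
  assumes "x \<in> partial_sums \<alpha>"
  shows "x \<le> sum_list \<alpha>"
proof -
  obtain k where "x = sum_list (take k \<alpha>)"
    using assms by (auto simp: partial_sums_def)
  then have "sum_list \<alpha> = x + sum_list (drop k \<alpha>)"
    using sum_list_append[of "take k \<alpha>" "drop k \<alpha>"] by simp
  then show ?thesis by simp
qed

lemma zero_in_partial_sums [simp]: "0 \<in> partial_sums \<alpha>"
  by (force simp: partial_sums_def)

lemma sum_list_in_partial_sums [simp]: "sum_list \<alpha> \<in> partial_sums \<alpha>"
  by (force simp: partial_sums_def)

text \<open>With a common seam value, each factor's partial sums can be read off those of the
  concatenation: truncation at the seam gives the first, shifting back by it the second.\<close>

lemma partial_sums_append_subset_iff:
  assumes "sum_list \<alpha> = sum_list \<alpha>'"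
  shows "partial_sums (\<alpha> @ \<beta>) \<subseteq> partial_sums (\<alpha>' @ \<beta>') \<longleftrightarrow>
    partial_sums \<alpha> \<subseteq> partial_sums \<alpha>' \<and> partial_sums \<beta> \<subseteq> partial_sums \<beta>'"
proof -
  \<comment> \<open>The two pieces meet only at the seam, which is the total of the first list and
    the shifted 0 of the second; here the kept endpoints matter.\<close>
  have lower: "partial_sums \<alpha> = partial_sums (\<alpha> @ \<beta>) \<inter> {..sum_list \<alpha>}" for \<alpha> \<beta>
    unfolding partial_sums_append by (auto dest: partial_sums_le)
  have upper: "partial_sums \<beta> = {x. sum_list \<alpha> + x \<in> partial_sums (\<alpha> @ \<beta>)}" for \<alpha> \<beta>
    unfolding partial_sums_append by (auto dest: partial_sums_le)
  show ?thesis
  proof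
    assume *: "partial_sums (\<alpha> @ \<beta>) \<subseteq> partial_sums (\<alpha>' @ \<beta>')"
    then show "partial_sums \<alpha> \<subseteq> partial_sums \<alpha>' \<and> partial_sums \<beta> \<subseteq> partial_sums \<beta>'"
      using assms lower[of \<alpha> \<beta>] lower[of \<alpha>' \<beta>'] upper[of \<beta> \<alpha>] upper[of \<beta>' \<alpha>'] by auto
  qed (use assms in \<open>auto simp: partial_sums_append\<close>)
qed

text \<open>Strict monotonicity turns excluding the positions 0 and \<open>length \<alpha>\<close>
  into excluding the values taken there.\<close>

lemma Des_eq_partial_sums:
  assumes "composition \<alpha>"
  shows "Des \<alpha> = partial_sums \<alpha> - {0, sum_list \<alpha>}"
proof
  show "Des \<alpha> \<subseteq> partial_sums \<alpha> - {0, sum_list \<alpha>}"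
  proof
    fix x assume "x \<in> Des \<alpha>"
    then obtain k where k: "x = sum_list (take k \<alpha>)" "1 \<le> k" "k < length \<alpha>"
      by (auto simp: Des_def)
    then show "x \<in> partial_sums \<alpha> - {0, sum_list \<alpha>}"
      using sum_list_take_strict_mono[OF assms, of 0 k]
        sum_list_take_strict_mono[OF assms, of k "length \<alpha>"]
      by (auto simp: partial_sums_def simp del: sum_list_eq_0_iff)
  qed
  show "partial_sums \<alpha> - {0, sum_list \<alpha>} \<subseteq> Des \<alpha>"
  proof
    fix x assume x: "x \<in> partial_sums \<alpha> - {0, sum_list \<alpha>}"
    then obtain k where k: "x = sum_list (take k \<alpha>)" "k \<le> length \<alpha>"
      by (auto simp: partial_sums_def)
    have "k \<noteq> 0" "k \<noteq> length \<alpha>" using x unfolding k(1) by (metis Diff_iff insertCI sum_list.Nil take0, auto)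
    with k show "x \<in> Des \<alpha>" by (auto simp: Des_def intro!: exI[of _ k])
  qed
qed

text \<open>The endpoints that \<open>Des\<close> omits are common to both lists once their totals
  agree, so they do not affect the inclusion.\<close>

lemma coarsenings_eq:
  assumes "composition \<alpha>"
  shows "coarsenings \<alpha> = {\<beta> \<in> Comp (sum_list \<alpha>). Des \<beta> \<subseteq> Des \<alpha>}"
proof -
  have "Des \<beta> \<subseteq> Des \<alpha> \<longleftrightarrow> partial_sums \<beta> \<subseteq> partial_sums \<alpha>"
    if "composition \<beta>" "sum_list \<beta> = sum_list \<alpha>" for \<beta>
    using that assms sum_list_in_partial_sums[of \<alpha>] by (auto simp: Des_eq_partial_sums)
  then show ?thesis by (auto simp: coarsenings_def Comp_def)
qed

lemma finite_coarsenings [simp]: "finite (coarsenings \<alpha>)"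
  by (rule finite_subset[OF _ finite_Comp[of "sum_list \<alpha>"]]) (auto simp: coarsenings_def Comp_def)

lemma enriched_monomial_eq:
  assumes "composition \<alpha>"
  shows "\<eta> \<alpha> = (\<Sum>\<beta>\<in>coarsenings \<alpha>. scale_qsym (2 ^ length \<beta>) (M \<beta>))"
  by (simp add: enriched_monomial_def coarsenings_eq[OF assms])

lemma append_in_coarsenings_iff:
  assumes "sum_list \<gamma> = sum_list \<alpha>"
  shows "\<gamma> @ \<delta> \<in> coarsenings (\<alpha> @ \<beta>) \<longleftrightarrow> \<gamma> \<in> coarsenings \<alpha> \<and> \<delta> \<in> coarsenings \<beta>"
  using assms by (auto simp: coarsenings_def partial_sums_append_subset_iff)

text \<open>This matches the terms of the two sides: coarsening both halves of a cut of \<alpha>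
  amounts to coarsening \<alpha> and then cutting the result.\<close>

lemma bij_betw_cut_coarsenings:
  assumes "composition \<alpha>"
  shows "bij_betw (\<lambda>(j, \<gamma>, \<delta>). (\<gamma> @ \<delta>, length \<gamma>))
    (SIGMA j:{0..length \<alpha>}. coarsenings (take j \<alpha>) \<times> coarsenings (drop j \<alpha>))
    (SIGMA \<beta>:coarsenings \<alpha>. {0..length \<beta>})" (is "bij_betw ?f ?S ?T")
  unfolding bij_betw_def
proof
  show "inj_on ?f ?S"
    \<comment> \<open>The image returns \<gamma> and \<delta> directly; \<open>j\<close> is
      recovered from the sum of \<gamma>, which is the partial sum of \<alpha> at
      \<open>j\<close>.\<close>
    by (rule inj_onI)
      (auto simp: coarsenings_def intro: sum_list_take_inj[OF assms])
  show "?f ` ?S = ?T"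
  proof
    show "?f ` ?S \<subseteq> ?T"
    proof clarsimp
      fix j \<gamma> \<delta>
      assume *: "\<gamma> \<in> coarsenings (take j \<alpha>)" "\<delta> \<in> coarsenings (drop j \<alpha>)"
      then have "sum_list \<gamma> = sum_list (take j \<alpha>)" by (simp add: coarsenings_def)
      then show "\<gamma> @ \<delta> \<in> coarsenings \<alpha>"
        using * append_in_coarsenings_iff[of \<gamma> "take j \<alpha>" \<delta> "drop j \<alpha>"] by simp
    qed
    show "?T \<subseteq> ?f ` ?S"
    proof clarsimp
      fix \<beta> k
      assume \<beta>: "\<beta> \<in> coarsenings \<alpha>" and k: "k \<le> length \<beta>"
      \<comment> \<open>The cut of \<alpha> is placed at the partial sum where \<beta> is cut; it
        exists because \<beta> coarsens \<alpha>.\<close>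
      then have "sum_list (take k \<beta>) \<in> partial_sums \<alpha>"
        by (auto simp: coarsenings_def partial_sums_def)
      then obtain j where j: "j \<le> length \<alpha>" "sum_list (take k \<beta>) = sum_list (take j \<alpha>)"
        by (auto simp: partial_sums_def)
      have "take k \<beta> \<in> coarsenings (take j \<alpha>)" "drop k \<beta> \<in> coarsenings (drop j \<alpha>)"
        using \<beta> append_in_coarsenings_iff[OF j(2), of "drop k \<beta>" "drop j \<alpha>"] by simp_all
      with j(1) k show "(\<beta>, k) \<in> ?f ` ?S"
        by (intro image_eqI[of _ _ "(j, take k \<beta>, drop k \<beta>)"]) auto
    qed
  qed
qed

lemma tensor_0 [simp]: "0 \<otimes> g = 0" "f \<otimes> 0 = 0"
  using tensor_bilinear(1)[of 0 0 g] tensor_bilinear(2)[of f 0 0] by simp_all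

lemma tensor_sum: "sum f A \<otimes> sum g B = (\<Sum>x\<in>A. \<Sum>y\<in>B. f x \<otimes> g y)"
proof -
  have "sum f A \<otimes> h = (\<Sum>x\<in>A. f x \<otimes> h)" for h
    by (induction A rule: infinite_finite_induct) (simp_all add: tensor_bilinear)
  moreover have "h \<otimes> sum g B = (\<Sum>y\<in>B. h \<otimes> g y)" for h
    by (induction B rule: infinite_finite_induct) (simp_all add: tensor_bilinear)
  ultimately show ?thesis
    by (simp add: sum.swap[of "\<lambda>x y. f x \<otimes> g y" B A])
qed

theorem theorem2:
  fixes \<alpha> :: "nat list"
  assumes "composition \<alpha>"
  shows "\<Delta> (\<eta> \<alpha> :: 'k::comm_unital_ring qsym) =
    (\<Sum>k=0..length \<alpha>. \<eta> (take k \<alpha>) \<otimes> \<eta> (drop k \<alpha>))"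
proof -
  \<comment> \<open>This form of the weight fits both sides: for the two pieces of \<beta> it is
    \<open>2 ^ length \<beta>\<close>, and it factors into the weights of \<gamma> and
    \<delta>.\<close>
  let ?t = "\<lambda>\<gamma> \<delta>. scale_tensor (2 ^ (length \<gamma> + length \<delta>)) (M \<gamma> \<otimes> M \<delta>) :: 'k qsym_tensor"
  have "\<Delta> (\<eta> \<alpha> :: 'k qsym) =
      (\<Sum>\<beta>\<in>coarsenings \<alpha>. scale_tensor (2 ^ length \<beta>) (\<Delta> (M \<beta>)))"
    unfolding enriched_monomial_eq[OF assms] linear_map_sum[OF coproduct_linear]
    using coproduct_linear by (intro sum.cong) (auto simp: linear_map_def)
  also have "\<dots> = (\<Sum>\<beta>\<in>coarsenings \<alpha>. \<Sum>k=0..length \<beta>. ?t (take k \<beta>) (drop k \<beta>))"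
    by (intro sum.cong) (auto simp: coarsenings_def coproduct_M scale_tensor_sum)
  also have "\<dots> = (\<Sum>(\<beta>, k)\<in>(SIGMA \<beta>:coarsenings \<alpha>. {0..length \<beta>}). ?t (take k \<beta>) (drop k \<beta>))"
    by (rule sum.Sigma) simp_all
  also have "\<dots> = (\<Sum>(j, \<gamma>, \<delta>)\<in>
      (SIGMA j:{0..length \<alpha>}. coarsenings (take j \<alpha>) \<times> coarsenings (drop j \<alpha>)). ?t \<gamma> \<delta>)"
    \<comment> \<open>Under the bijection \<beta> is \<open>\<gamma> @ \<delta>\<close> and
      \<open>k\<close> is \<open>length \<gamma>\<close>, so \<open>take\<close> and
      \<open>drop\<close> give back \<gamma> and \<delta>.\<close>
    unfolding sum.reindex_bij_betw[OF bij_betw_cut_coarsenings[OF assms], symmetric]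
    by (rule sum.cong) auto
  also have "\<dots> = (\<Sum>j=0..length \<alpha>. \<Sum>\<gamma>\<in>coarsenings (take j \<alpha>). \<Sum>\<delta>\<in>coarsenings (drop j \<alpha>). ?t \<gamma> \<delta>)"
    unfolding sum.cartesian_product by (rule sum.Sigma[symmetric]) simp_all
  also have "\<dots> = (\<Sum>j=0..length \<alpha>. \<eta> (take j \<alpha>) \<otimes> \<eta> (drop j \<alpha>))"
    \<comment> \<open>Bilinearity moves the two powers of 2 out of the tensor factors, where they
      multiply to the joint weight.\<close>
    using assms
    by (simp add: enriched_monomial_eq composition_take composition_drop tensor_sum
        tensor_bilinear(3,4) scale_tensor_simps(3) power_add mult.commute)
  finally show ?thesis .
qed

end
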